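(* For every $n\ge 0$ there exist $s=s(n)\in\{0,1\}$ and a complex structure on $\mathbb R^s\oplus\mathfrak e(n)$, where $\mathfrak e(n)$ is the Euclidean Lie algebra, such that for every nonnegative integer $k$ the following inclusions are holomorphic (i.e. intertwine the complex structures): $$\mathfrak e(4k)\hookrightarrow\mathfrak e(4k+1)\oplus\mathbb R e_{4k+2}\hookrightarrow\mathfrak e(4k+2)\oplus\mathbb R e_{4k+3}\hookrightarrow\mathfrak e(4k+3).$$
   Context: A complex structure on a real Lie algebra $\mathfrak g$ is an endomorphism $J$ with $J^2=-1$ and $J[x,y]-[Jx,y]-[x,Jy]-J[Jx,Jy]=0$ for all $x,y\in\mathfrak g$. $\mathfrak e(n)=\mathfrak{so}(n)\oplus_\rho\mathbb R^n$, with $\rho$ the standard representation of $\mathfrak{so}(n)$ on column vectors, and bracket $[(x,u),(y,v)]=([x,y],xv-yu)$ (and $\mathfrak e(0)=0$). $\mathbb R^s\oplus\mathfrak e(n)$ is the direct sum of Lie algebras with $\mathbb R^s$ abelian (a trivial central extension). In the chain of inclusions, $s=0$ for $\mathfrak e(4k)$ and $\mathfrak e(4k+3)$, and $s=1$ for $\mathfrak e(4k+1)\oplus\mathbb R e_{4k+2}$ and $\mathfrak e(4k+2)\oplus\mathbb R e_{4k+3}$, where $\mathbb R e_{n+1}$ denotes a one-dimensional central direct summand $\mathbb R$ of $\mathfrak e(n)\oplus\mathbb R e_{n+1}$. The inclusions are the natural ones: $\mathfrak e(m)\subset\mathfrak e(m+1)$ via the upper-left block $\mathfrak{so}(m)\subset\mathfrak{so}(m+1)$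 and $\mathbb R^m=\mathrm{span}\{e_1,\dots,e_m\}\subset\mathbb R^{m+1}$, and the central generator $e_{m+1}$ of $\mathfrak e(m)\oplus\mathbb R e_{m+1}$ is sent to the standard translation vector $e_{m+1}\in\mathbb R^{m+1}\subset\mathfrak e(m+1)$. *)

theory Defs
  imports "Jordan_Normal_Form.VS_Connect"
begin

section \<open>Real Lie algebras and complex structures\<close>

text \<open>Real vector spaces are \<open>class_ring\<close>-modules over the type \<^typ>\<open>real\<close>; as for
  \<^const>\<open>module_vec\<close>, the ring multiplication and unit inherited from the record type of modules
  play no role.\<close>

record 'a lie = "(real, 'a) module" +
  lie_bracket :: "'a \<Rightarrow> 'a \<Rightarrow> 'a"

definition with_bracket :: "(real, 'a) module \<Rightarrow> ('a \<Rightarrow> 'a \<Rightarrow> 'a) \<Rightarrow> 'a lie" where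
  "with_bracket V b = module.extend V (lie.fields b)"

locale real_lie_algebra = vectorspace "class_ring :: real ring" L
  for L :: "('a, 'm) lie_scheme" (structure) +
  assumes bracket_closed:
    "\<lbrakk>x \<in> carrier L; y \<in> carrier L\<rbrakk> \<Longrightarrow> lie_bracket L x y \<in> carrier L"
  and bracket_add_left:
    "\<lbrakk>x \<in> carrier L; y \<in> carrier L; z \<in> carrier L\<rbrakk>
      \<Longrightarrow> lie_bracket L (x \<oplus> y) z = lie_bracket L x z \<oplus> lie_bracket L y z"
  and bracket_add_right:
    "\<lbrakk>x \<in> carrier L; y \<in> carrier L; z \<in> carrier L\<rbrakk>
      \<Longrightarrow> lie_bracket L x (y \<oplus> z) = lie_bracket L x y \<oplus> lie_bracket L x z"
  and bracket_smult_left: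
    "\<lbrakk>x \<in> carrier L; y \<in> carrier L\<rbrakk>
      \<Longrightarrow> lie_bracket L (c \<odot> x) y = c \<odot> lie_bracket L x y"
  and bracket_smult_right:
    "\<lbrakk>x \<in> carrier L; y \<in> carrier L\<rbrakk>
      \<Longrightarrow> lie_bracket L x (c \<odot> y) = c \<odot> lie_bracket L x y"
  and bracket_self: "x \<in> carrier L \<Longrightarrow> lie_bracket L x x = \<zero>"
  and jacobi:
    "\<lbrakk>x \<in> carrier L; y \<in> carrier L; z \<in> carrier L\<rbrakk>
      \<Longrightarrow> lie_bracket L x (lie_bracket L y z) \<oplus> lie_bracket L y (lie_bracket L z x)
            \<oplus> lie_bracket L z (lie_bracket L x y) = \<zero>"

locale complex_structure = real_lie_algebra L + linear_map "class_ring :: real ring" L L J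
  for L :: "('a, 'm) lie_scheme" (structure) and J :: "'a \<Rightarrow> 'a" +
  assumes J_square: "x \<in> carrier L \<Longrightarrow> J (J x) = \<ominus> x"
  and integrable:
    "\<lbrakk>x \<in> carrier L; y \<in> carrier L\<rbrakk>
      \<Longrightarrow> J (lie_bracket L x y) \<ominus> lie_bracket L (J x) y \<ominus> lie_bracket L x (J y)
            \<ominus> J (lie_bracket L (J x) (J y)) = \<zero>"

definition lie_embedding ::
    "('a, 'm) lie_scheme \<Rightarrow> ('b, 'n) lie_scheme \<Rightarrow> ('a \<Rightarrow> 'b) \<Rightarrow> bool" where
  "lie_embedding L M \<phi> \<longleftrightarrow>
     linear_map (class_ring :: real ring) L M \<phi> \<and> inj_on \<phi> (carrier L) \<and>
     (\<forall>x\<in>carrier L. \<forall>y\<in>carrier L. \<phi> (lie_bracket L x y) = lie_bracket M (\<phi> x) (\<phi> y))"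

text \<open>\<open>\<phi> : (L, J) \<rightarrow> (M, J')\<close> intertwines \<open>J\<close> and \<open>J'\<close>.\<close>

definition holomorphic ::
    "('a, 'm) lie_scheme \<Rightarrow> ('a \<Rightarrow> 'a) \<Rightarrow> ('b \<Rightarrow> 'b) \<Rightarrow> ('a \<Rightarrow> 'b) \<Rightarrow> bool" where
  "holomorphic L J J' \<phi> \<longleftrightarrow> (\<forall>x\<in>carrier L. \<phi> (J x) = J' (\<phi> x))"


section \<open>The Lie algebras\<close>

definition lie_direct_sum :: "('a, 'm) lie_scheme \<Rightarrow> ('b, 'n) lie_scheme \<Rightarrow> ('a \<times> 'b) lie" where
  "lie_direct_sum L M = with_bracket (direct_sum L M)
     (\<lambda>(x, u) (y, v). (lie_bracket L x y, lie_bracket M u v))"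

definition abelian_lie :: "nat \<Rightarrow> real vec lie" where
  "abelian_lie s = with_bracket (module_vec TYPE(real) s) (\<lambda>_ _. 0\<^sub>v s)"

definition so_lie :: "nat \<Rightarrow> real mat lie" where
  "so_lie n = with_bracket
     ((module_mat TYPE(real) n n)\<lparr>carrier := {A \<in> carrier_mat n n. transpose_mat A = - A}\<rparr>)
     (\<lambda>A B. A * B - B * A)"

definition euclid_lie :: "nat \<Rightarrow> (real mat \<times> real vec) lie" where
  "euclid_lie n = with_bracket (direct_sum (so_lie n) (module_vec TYPE(real) n))
     (\<lambda>(A, u) (B, v). (lie_bracket (so_lie n) A B, A *\<^sub>v v - B *\<^sub>v u))"

definition ext_euclid :: "nat \<Rightarrow> nat \<Rightarrow> (real vec \<times> real mat \<times> real vec) lie" where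
  "ext_euclid s n = lie_direct_sum (abelian_lie s) (euclid_lie n)"


section \<open>The natural inclusions\<close>

text \<open>The inclusion \<open>\<real>\<^sup>s \<oplus> \<ee>(n) \<rightarrow> \<real>\<^sup>s\<^sup>' \<oplus> \<ee>(n + 1)\<close> for \<open>s \<le> 1\<close>. Its image lies in the
  summand \<open>\<ee>(n + 1)\<close>. A matrix becomes the upper left block, and the vector part is
  \<open>(u, t)\<close> if \<open>s = 1\<close>, so that the central generator goes to the last standard basis vector,
  and \<open>(u, 0)\<close> if \<open>s = 0\<close>.\<close>

definition pad_mat :: "nat \<Rightarrow> real mat \<Rightarrow> real mat" where
  "pad_mat n A = four_block_mat A (0\<^sub>m n 1) (0\<^sub>m 1 n) (0\<^sub>m 1 1)"

definition natural_incl ::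
    "nat \<Rightarrow> nat \<Rightarrow> nat \<Rightarrow> real vec \<times> real mat \<times> real vec \<Rightarrow> real vec \<times> real mat \<times> real vec"
  where
  "natural_incl s s' n = (\<lambda>(t, A, u). (0\<^sub>v s', pad_mat n A, u @\<^sub>v (t @\<^sub>v 0\<^sub>v (1 - s))))"


section \<open>Basic facts\<close>

lemma with_bracket_simps [simp]:
  "carrier (with_bracket V b) = carrier V"
  "add (with_bracket V b) = add V"
  "zero (with_bracket V b) = zero V"
  "smult (with_bracket V b) = smult V"
  "lie_bracket (with_bracket V b) = b"
  by (simp_all add: with_bracket_def module.defs lie.defs)

lemma direct_sum_simps [simp]:
  "carrier (direct_sum V W) = carrier V \<times> carrier W"
  "add (direct_sum V W) = (\<lambda>v w. (fst v \<oplus>\<^bsub>V\<^esub> fst w, snd v \<oplus>\<^bsub>W\<^esub> snd w))"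
  "zero (direct_sum V W) = (\<zero>\<^bsub>V\<^esub>, \<zero>\<^bsub>W\<^esub>)"
  "smult (direct_sum V W) = (\<lambda>c v. (c \<odot>\<^bsub>V\<^esub> fst v, c \<odot>\<^bsub>W\<^esub> snd v))"
  by (simp_all add: direct_sum_def)

lemma so_lie_simps [simp]:
  "carrier (so_lie n) = {A \<in> carrier_mat n n. transpose_mat A = - A}"
  "add (so_lie n) = (+)"
  "zero (so_lie n) = 0\<^sub>m n n"
  "smult (so_lie n) = (\<cdot>\<^sub>m)"
  "lie_bracket (so_lie n) A B = A * B - B * A"
  by (simp_all add: so_lie_def module_mat_simps)

lemma euclid_lie_simps [simp]:
  "carrier (euclid_lie n) = carrier (so_lie n) \<times> carrier_vec n"
  "(A, u) \<oplus>\<^bsub>euclid_lie n\<^esub> (B, v) = (A + B, u + v)"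
  "zero (euclid_lie n) = (0\<^sub>m n n, 0\<^sub>v n)"
  "c \<odot>\<^bsub>euclid_lie n\<^esub> (A, u) = (c \<cdot>\<^sub>m A, c \<cdot>\<^sub>v u)"
  "lie_bracket (euclid_lie n) (A, u) (B, v) = (A * B - B * A, A *\<^sub>v v - B *\<^sub>v u)"
  by (simp_all add: euclid_lie_def module_vec_simps)

lemma abelian_lie_simps [simp]:
  "carrier (abelian_lie s) = carrier_vec s"
  "add (abelian_lie s) = (+)"
  "zero (abelian_lie s) = 0\<^sub>v s"
  "smult (abelian_lie s) = (\<cdot>\<^sub>v)"
  "lie_bracket (abelian_lie s) t t' = 0\<^sub>v s"
  by (simp_all add: abelian_lie_def module_vec_simps)

lemma ext_euclid_simps [simp]:
  "carrier (ext_euclid s n) = carrier_vec s \<times> carrier (euclid_lie n)"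
  "(t, X) \<oplus>\<^bsub>ext_euclid s n\<^esub> (t', Y) = (t + t', X \<oplus>\<^bsub>euclid_lie n\<^esub> Y)"
  "zero (ext_euclid s n) = (0\<^sub>v s, 0\<^sub>m n n, 0\<^sub>v n)"
  "c \<odot>\<^bsub>ext_euclid s n\<^esub> (t, X) = (c \<cdot>\<^sub>v t, c \<odot>\<^bsub>euclid_lie n\<^esub> X)"
  "lie_bracket (ext_euclid s n) (t, X) (t', Y) = (0\<^sub>v s, lie_bracket (euclid_lie n) X Y)"
  by (simp_all add: ext_euclid_def lie_direct_sum_def)

lemma vectorspace_cong:
  assumes "vectorspace K V" and eq: "carrier W = carrier V" "add W = add V" "zero W = zero V"
    "smult W = smult V"
  shows "vectorspace K W"
proof -
  interpret vectorspace K V by fact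
  have "abelian_group W"
    by (rule abelian_groupI) (auto simp: eq M.a_ac intro: bexI[of _ "\<ominus>\<^bsub>V\<^esub> x" for x] M.l_neg)
  moreover have "module_axioms K W"
    unfolding module_axioms_def
    by (auto simp: eq smult_l_distr smult_r_distr smult_assoc1)
  ultimately show ?thesis
    using assms(1) by (simp add: vectorspace_def Module.module_def)
qed

lemma vectorspace_with_bracket:
  "vectorspace K V \<Longrightarrow> vectorspace K (with_bracket V b)"
  by (erule vectorspace_cong) simp_all

lemma vectorspace_so: "vectorspace class_ring (so_lie n)"
proof -
  let ?M = "module_mat TYPE(real) n n" and ?N = "{A \<in> carrier_mat n n. transpose_mat A = - (A :: real mat)}"
  interpret vectorspace class_ring ?M by (rule matrix_vs)
  have "submodule class_ring ?N ?M"
  proof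
    show "?N \<subseteq> carrier ?M" by (auto simp: module_mat_simps)
    fix v w assume vw: "v \<in> ?N" "w \<in> ?N"
    then have "transpose_mat (v + w) = - v + - w" by (auto simp: transpose_add)
    also have "\<dots> = - (v + w)" using vw by (intro eq_matI) auto
    finally show "v \<oplus>\<^bsub>?M\<^esub> w \<in> ?N" using vw by (auto simp: module_mat_simps)
  next
    fix c :: real and v assume v: "v \<in> ?N"
    have "transpose_mat (c \<cdot>\<^sub>m v) = c \<cdot>\<^sub>m transpose_mat v" by (intro eq_matI) auto
    also have "\<dots> = - (c \<cdot>\<^sub>m v)" using v by (intro eq_matI) auto
    finally show "c \<odot>\<^bsub>?M\<^esub> v \<in> ?N" using v by (auto simp: module_mat_simps)
  qed (auto simp: module_mat_simps zero_transpose_mat intro!: eq_matI)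
  then have "module class_ring (?M\<lparr>carrier := ?N\<rparr>)" by (rule submodule_is_module)
  then have "vectorspace class_ring (?M\<lparr>carrier := ?N\<rparr>)"
    using matrix_vs[where 'a = real] by (simp add: vectorspace_def)
  then show ?thesis unfolding so_lie_def by (rule vectorspace_with_bracket)
qed

lemma vectorspace_euclid: "vectorspace class_ring (euclid_lie n)"
  unfolding euclid_lie_def
  by (intro vectorspace_with_bracket direct_sum_is_vs vectorspace_so vec_vs)

lemma lie_algebra_abelian: "real_lie_algebra (abelian_lie s)"
proof -
  interpret vectorspace "class_ring :: real ring" "abelian_lie s"
    unfolding abelian_lie_def by (intro vectorspace_with_bracket vec_vs)
  show ?thesis by unfold_locales auto
qed

lemma lie_algebra_euclid: "real_lie_algebra (euclid_lie n)"
proof -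
  interpret vectorspace "class_ring :: real ring" "euclid_lie n"
    by (rule vectorspace_euclid)
  have regroup: "(P + Q) - (R + S) = P - R + (Q - S)"
    if "P \<in> carrier_mat n n" "Q \<in> carrier_mat n n" "R \<in> carrier_mat n n" "S \<in> carrier_mat n n"
    for P Q R S :: "real mat"
    using that by (intro eq_matI) auto
  have regroup_vec: "(P + Q) - (R + S) = P - R + (Q - S)"
    if "P \<in> carrier_vec n" "Q \<in> carrier_vec n" "R \<in> carrier_vec n" "S \<in> carrier_vec n"
    for P Q R S :: "real vec"
    using that by (intro eq_vecI) auto
  have scale: "c \<cdot>\<^sub>m P - c \<cdot>\<^sub>m Q = c \<cdot>\<^sub>m (P - Q)"
    if "P \<in> carrier_mat n n" "Q \<in> carrier_mat n n" for c and P Q :: "real mat"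
    using that by (intro eq_matI) (auto simp: algebra_simps)
  have scale_vec: "c \<cdot>\<^sub>v p - c \<cdot>\<^sub>v q = c \<cdot>\<^sub>v (p - q)"
    if "p \<in> carrier_vec n" "q \<in> carrier_vec n" for c and p q :: "real vec"
    using that by (intro eq_vecI) (auto simp: algebra_simps)
  have smult_left: "(c \<cdot>\<^sub>m M) *\<^sub>v p = c \<cdot>\<^sub>v (M *\<^sub>v p)"
    if "M \<in> carrier_mat n n" "p \<in> carrier_vec n" for c p and M :: "real mat"
    using that by (intro eq_vecI) (auto simp: scalar_prod_def sum_distrib_left mult.assoc)
  show ?thesis
  proof (unfold_locales, goal_cases)
    case (1 x y)
    obtain A u B v where xy: "x = (A, u)" "y = (B, v)" by (cases x, cases y) auto
    have "transpose_mat (A * B - B * A) = (- B) * (- A) - (- A) * (- B)"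
      using 1 by (auto simp: xy transpose_minus[of _ n n] transpose_mult[of _ n n _ n])
    also have "\<dots> = B * A - A * B" using 1 by (auto simp: xy)
    also have "\<dots> = - (A * B - B * A)" using 1 by (intro eq_matI) (auto simp: xy)
    finally show ?case using 1 by (auto simp: xy)
  next
    case (2 x y z)
    obtain A u B v C w where xyz: "x = (A, u)" "y = (B, v)" "z = (C, w)"
      by (cases x, cases y, cases z) auto
    have c [simp]: "A \<in> carrier_mat n n" "B \<in> carrier_mat n n" "C \<in> carrier_mat n n"
      "u \<in> carrier_vec n" "v \<in> carrier_vec n" "w \<in> carrier_vec n"
      using 2 by (auto simp: xyz)
    have "(A + B) * C - C * (A + B) = A * C - C * A + (B * C - C * B)"
      unfolding add_mult_distrib_mat[OF c(1,2,3)] mult_add_distrib_mat[OF c(3,1,2)]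
      by (intro regroup) (rule mult_carrier_mat c)+
    moreover have "(A + B) *\<^sub>v w - C *\<^sub>v (u + v) = A *\<^sub>v w - C *\<^sub>v u + (B *\<^sub>v w - C *\<^sub>v v)"
      unfolding add_mult_distrib_mat_vec[OF c(1,2,6)] mult_add_distrib_mat_vec[OF c(3,4,5)]
      by (intro regroup_vec) (rule mult_mat_vec_carrier c)+
    ultimately show ?case by (simp add: xyz)
  next
    case (3 x y z)
    obtain C w A u B v where xyz: "x = (C, w)" "y = (A, u)" "z = (B, v)"
      by (cases x, cases y, cases z) auto
    have c [simp]: "A \<in> carrier_mat n n" "B \<in> carrier_mat n n" "C \<in> carrier_mat n n"
      "u \<in> carrier_vec n" "v \<in> carrier_vec n" "w \<in> carrier_vec n"
      using 3 by (auto simp: xyz)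
    have "C * (A + B) - (A + B) * C = C * A - A * C + (C * B - B * C)"
      unfolding add_mult_distrib_mat[OF c(1,2,3)] mult_add_distrib_mat[OF c(3,1,2)]
      by (intro regroup) (rule mult_carrier_mat c)+
    moreover have "C *\<^sub>v (u + v) - (A + B) *\<^sub>v w = C *\<^sub>v u - A *\<^sub>v w + (C *\<^sub>v v - B *\<^sub>v w)"
      unfolding add_mult_distrib_mat_vec[OF c(1,2,6)] mult_add_distrib_mat_vec[OF c(3,4,5)]
      by (intro regroup_vec) (rule mult_mat_vec_carrier c)+
    ultimately show ?case by (simp add: xyz)
  next
    case (4 x y c)
    obtain A u B v where xy: "x = (A, u)" "y = (B, v)" by (cases x, cases y) auto
    have [simp]: "A \<in> carrier_mat n n" "B \<in> carrier_mat n n" "u \<in> carrier_vec n" "v \<in> carrier_vec n"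
      using 4 by (auto simp: xy)
    have "c \<cdot>\<^sub>m A * B - B * (c \<cdot>\<^sub>m A) = c \<cdot>\<^sub>m (A * B - B * A)"
      by (subst mult_smult_assoc_mat[of _ n n _ n], simp, simp, subst mult_smult_distrib[of _ n n _ n], simp, simp)
        (rule scale, (rule mult_carrier_mat[of _ n n]; simp)+)
    moreover have "c \<cdot>\<^sub>m A *\<^sub>v v - B *\<^sub>v (c \<cdot>\<^sub>v u) = c \<cdot>\<^sub>v (A *\<^sub>v v - B *\<^sub>v u)"
      by (simp add: smult_left mult_mat_vec[of _ n n] scale_vec[OF mult_mat_vec_carrier[of _ n n] mult_mat_vec_carrier[of _ n n]])
    ultimately show ?case by (simp add: xy)
  next
    case (5 x y c)
    obtain A u B v where xy: "x = (A, u)" "y = (B, v)" by (cases x, cases y) auto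
    have [simp]: "A \<in> carrier_mat n n" "B \<in> carrier_mat n n" "u \<in> carrier_vec n" "v \<in> carrier_vec n"
      using 5 by (auto simp: xy)
    have "A * (c \<cdot>\<^sub>m B) - c \<cdot>\<^sub>m B * A = c \<cdot>\<^sub>m (A * B - B * A)"
      by (subst mult_smult_assoc_mat[of _ n n _ n], simp, simp, subst mult_smult_distrib[of _ n n _ n], simp, simp)
        (rule scale, (rule mult_carrier_mat[of _ n n]; simp)+)
    moreover have "A *\<^sub>v (c \<cdot>\<^sub>v v) - c \<cdot>\<^sub>m B *\<^sub>v u = c \<cdot>\<^sub>v (A *\<^sub>v v - B *\<^sub>v u)"
      by (simp add: smult_left mult_mat_vec[of _ n n] scale_vec[OF mult_mat_vec_carrier[of _ n n] mult_mat_vec_carrier[of _ n n]])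
    ultimately show ?case by (simp add: xy)
  next
    case (6 x)
    then show ?case by (cases x) auto
  next
    case (7 x y z)
    obtain A u B v C w where xyz: "x = (A, u)" "y = (B, v)" "z = (C, w)"
      by (cases x, cases y, cases z) auto
    have c [simp]: "A \<in> carrier_mat n n" "B \<in> carrier_mat n n" "C \<in> carrier_mat n n"
      "u \<in> carrier_vec n" "v \<in> carrier_vec n" "w \<in> carrier_vec n"
      using 7 by (auto simp: xyz)
    have [simp]: "X * Y \<in> carrier_mat n n"
      if "X \<in> carrier_mat n n" "Y \<in> carrier_mat n n" for X Y :: "real mat"
      using that by auto
    have [simp]: "X *\<^sub>v a \<in> carrier_vec n"
      if "X \<in> carrier_mat n n" "a \<in> carrier_vec n" for X :: "real mat" and a
      using that by auto
    have m: "X * (Y * Z - Z * Y) - (Y * Z - Z * Y) * X = (X * (Y * Z) - X * (Z * Y)) - (Y * (Z * X) - Z * (Y * X))"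
      if [simp]: "X \<in> carrier_mat n n" "Y \<in> carrier_mat n n" "Z \<in> carrier_mat n n" for X Y Z :: "real mat"
      by (simp add: mult_minus_distrib_mat[of _ n n _ n] minus_mult_distrib_mat[of _ n n _ _ n]
          assoc_mult_mat[of _ n n _ n _ n])
    have mv: "X *\<^sub>v (Y *\<^sub>v c - Z *\<^sub>v b) - (Y * Z - Z * Y) *\<^sub>v a
        = (X *\<^sub>v (Y *\<^sub>v c) - X *\<^sub>v (Z *\<^sub>v b)) - (Y *\<^sub>v (Z *\<^sub>v a) - Z *\<^sub>v (Y *\<^sub>v a))"
      if [simp]: "X \<in> carrier_mat n n" "Y \<in> carrier_mat n n" "Z \<in> carrier_mat n n"
        "a \<in> carrier_vec n" "b \<in> carrier_vec n" "c \<in> carrier_vec n" for X Y Z :: "real mat" and a b c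
      by (simp add: mult_minus_distrib_mat_vec[of _ n n] minus_mult_distrib_mat_vec[of _ n n]
          assoc_mult_mat_vec[of _ n n _ n])
    have cancel: "((P - Q) - (R - S)) + ((R - T) - (U - Q)) + ((U - S) - (P - T)) = 0\<^sub>m n n"
      if "P \<in> carrier_mat n n" "Q \<in> carrier_mat n n" "R \<in> carrier_mat n n" "S \<in> carrier_mat n n"
        "T \<in> carrier_mat n n" "U \<in> carrier_mat n n" for P Q R S T U :: "real mat"
      using that by (intro eq_matI) auto
    have cancel_vec: "((P - Q) - (R - S)) + ((R - T) - (U - Q)) + ((U - S) - (P - T)) = 0\<^sub>v n"
      if "P \<in> carrier_vec n" "Q \<in> carrier_vec n" "R \<in> carrier_vec n" "S \<in> carrier_vec n"
        "T \<in> carrier_vec n" "U \<in> carrier_vec n" for P Q R S T U :: "real vec"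
      using that by (intro eq_vecI) auto
    show ?case by (simp add: xyz m mv) (intro conjI cancel cancel_vec, (rule mult_carrier_mat mult_mat_vec_carrier c)+)
  qed
qed

lemma lie_algebra_direct_sum:
  assumes "real_lie_algebra L" and "real_lie_algebra M"
  shows "real_lie_algebra (lie_direct_sum L M)"
proof -
  interpret L: real_lie_algebra L by fact
  interpret M: real_lie_algebra M by fact
  interpret vectorspace "class_ring :: real ring" "lie_direct_sum L M"
    unfolding lie_direct_sum_def
    by (intro vectorspace_with_bracket direct_sum_is_vs L.vectorspace_axioms M.vectorspace_axioms)
  show ?thesis
    by unfold_locales
      (auto simp: lie_direct_sum_def L.bracket_closed M.bracket_closed
        L.bracket_add_left L.bracket_add_right M.bracket_add_left M.bracket_add_right
        L.bracket_smult_left L.bracket_smult_right M.bracket_smult_left M.bracket_smult_right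
        L.bracket_self M.bracket_self L.jacobi M.jacobi)
qed

lemma lie_algebra_ext_euclid: "real_lie_algebra (ext_euclid s n)"
  unfolding ext_euclid_def
  by (intro lie_algebra_direct_sum lie_algebra_abelian lie_algebra_euclid)

lemma ext_euclid_trivial: "carrier (ext_euclid 0 0) = {\<zero>\<^bsub>ext_euclid 0 0\<^esub>}"
  by (auto intro!: eq_matI eq_vecI)

lemma natural_incl_embedding:
  assumes "s \<le> 1"
  shows "lie_embedding (ext_euclid s n) (ext_euclid s' (n + 1)) (natural_incl s s' n)"
proof -
  let ?L = "ext_euclid s n" and ?M = "ext_euclid s' (n + 1)" and ?i = "natural_incl s s' n"
  interpret L: real_lie_algebra ?L by (rule lie_algebra_ext_euclid)
  interpret M: real_lie_algebra ?M by (rule lie_algebra_ext_euclid)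
  have pad_carrier: "pad_mat n A \<in> carrier_mat (n + 1) (n + 1)" if "A \<in> carrier_mat n n" for A
    using that unfolding pad_mat_def by auto
  have pad_add: "pad_mat n (A + B) = pad_mat n A + pad_mat n B"
    if "A \<in> carrier_mat n n" "B \<in> carrier_mat n n" for A B
    using that unfolding pad_mat_def by (intro eq_matI) auto
  have pad_minus: "pad_mat n (A - B) = pad_mat n A - pad_mat n B"
    if "A \<in> carrier_mat n n" "B \<in> carrier_mat n n" for A B
    using that unfolding pad_mat_def by (intro eq_matI) auto
  have pad_uminus: "pad_mat n (- A) = - pad_mat n A" if "A \<in> carrier_mat n n" for A
    using that unfolding pad_mat_def by (intro eq_matI) auto
  have pad_smult: "pad_mat n (c \<cdot>\<^sub>m A) = c \<cdot>\<^sub>m pad_mat n A" if "A \<in> carrier_mat n n" for c A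
    using that unfolding pad_mat_def by (intro eq_matI) auto
  have pad_transpose: "transpose_mat (pad_mat n A) = pad_mat n (transpose_mat A)"
    if "A \<in> carrier_mat n n" for A
    using that unfolding pad_mat_def by (intro eq_matI) auto
  have pad_mult: "pad_mat n (A * B) = pad_mat n A * pad_mat n B"
    if "A \<in> carrier_mat n n" "B \<in> carrier_mat n n" for A B
    using that unfolding pad_mat_def
    by (subst mult_four_block_mat[of _ n n _ 1 _ 1 _ _ n _ 1]) auto
  have pad_vec: "pad_mat n A *\<^sub>v (u @\<^sub>v w) = (A *\<^sub>v u) @\<^sub>v 0\<^sub>v 1"
    if "A \<in> carrier_mat n n" "u \<in> carrier_vec n" "w \<in> carrier_vec 1" for A u w
    using that unfolding pad_mat_def
    by (subst four_block_mat_mult_vec[of _ n n _ 1 _ 1]) auto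
  have pad_inj: "A = B" if "pad_mat n A = pad_mat n B" "A \<in> carrier_mat n n" "B \<in> carrier_mat n n"
    for A B
  proof (rule eq_matI)
    fix i j assume "i < dim_row B" "j < dim_col B"
    then show "A $$ (i, j) = B $$ (i, j)"
      using arg_cong[OF that(1), of "\<lambda>M. M $$ (i, j)"] that(2,3) by (simp add: pad_mat_def)
  qed (use that in auto)
  have tail: "t @\<^sub>v 0\<^sub>v (1 - s) \<in> carrier_vec 1" if "t \<in> carrier_vec s" for t :: "real vec"
    using that assms by (intro carrier_vecI) auto
  have "?i \<in> LinearCombinations.module_hom class_ring ?L ?M"
    unfolding LinearCombinations.module_hom_def
  proof (safe, goal_cases)
    case (1 t A u)
    then have "u @\<^sub>v (t @\<^sub>v 0\<^sub>v (1 - s)) \<in> carrier_vec (n + 1)"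
      by (intro append_carrier_vec tail) auto
    with 1 show ?case
      by (auto simp: natural_incl_def pad_carrier[simplified] pad_transpose pad_uminus)
  next
    case (2 t A u t' B v)
    then show ?case
      by (auto simp: natural_incl_def pad_add append_vec_def intro!: eq_vecI)
  next
    case (3 c t A u)
    then show ?case
      by (auto simp: natural_incl_def pad_smult append_vec_def intro!: eq_vecI)
  qed
  then have "linear_map class_ring ?L ?M ?i"
    by (intro linear_map.intro mod_hom.intro mod_hom_axioms.intro L.vectorspace_axioms
        M.vectorspace_axioms L.module_axioms M.module_axioms)
  moreover have "inj_on ?i (carrier ?L)"
  proof (rule inj_onI)
    fix X Y assume 1: "X \<in> carrier ?L" "Y \<in> carrier ?L" "?i X = ?i Y"
    obtain t A u t' B v where XY: "X = (t, A, u)" "Y = (t', B, v)" by (cases X, cases Y) auto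
    with 1 have c: "A \<in> carrier_mat n n" "B \<in> carrier_mat n n" "u \<in> carrier_vec n"
      "v \<in> carrier_vec n" "t \<in> carrier_vec s" "t' \<in> carrier_vec s" by auto
    from 1 have e: "pad_mat n A = pad_mat n B"
      "u @\<^sub>v (t @\<^sub>v 0\<^sub>v (1 - s)) = v @\<^sub>v (t' @\<^sub>v 0\<^sub>v (1 - s))"
      by (auto simp: natural_incl_def XY)
    have "u = v \<and> t = t'"
      using e(2) append_vec_eq[OF c(3,4)] append_vec_eq[OF c(5,6)] by auto
    with pad_inj[OF e(1) c(1,2)] show "X = Y" by (simp add: XY)
  qed
  moreover have "?i (lie_bracket ?L X Y) = lie_bracket ?M (?i X) (?i Y)"
    if "X \<in> carrier ?L" "Y \<in> carrier ?L" for X Y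
  proof -
    obtain t A u t' B v where XY: "X = (t, A, u)" "Y = (t', B, v)" by (cases X, cases Y) auto
    with that have c [simp]: "A \<in> carrier_mat n n" "B \<in> carrier_mat n n" "u \<in> carrier_vec n"
      "v \<in> carrier_vec n" "t \<in> carrier_vec s" "t' \<in> carrier_vec s" by auto
    have "pad_mat n (A * B - B * A) = pad_mat n A * pad_mat n B - pad_mat n B * pad_mat n A"
      by (simp add: pad_minus[OF mult_carrier_mat[OF c(1,2)] mult_carrier_mat[OF c(2,1)]] pad_mult)
    moreover have "(A *\<^sub>v v - B *\<^sub>v u) @\<^sub>v (0\<^sub>v s @\<^sub>v 0\<^sub>v (1 - s))
        = ((A *\<^sub>v v) @\<^sub>v 0\<^sub>v 1) - ((B *\<^sub>v u) @\<^sub>v 0\<^sub>v 1)"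
      using assms by (intro eq_vecI) (auto simp: append_vec_def carrier_matD[OF c(1)] carrier_matD[OF c(2)])
    moreover note pad_vec[OF c(1,4) tail[OF c(6)]] pad_vec[OF c(2,3) tail[OF c(5)]]
    ultimately show ?thesis
      by (simp add: XY natural_incl_def)
  qed
  ultimately show ?thesis by (simp add: lie_embedding_def)
qed

lemma natural_incl_central:
  "natural_incl 1 s' n (unit_vec 1 0, 0\<^sub>m n n, 0\<^sub>v n) = (0\<^sub>v s', 0\<^sub>m (n + 1) (n + 1), unit_vec (n + 1) n)"
  by (auto simp: natural_incl_def pad_mat_def append_vec_def intro!: eq_vecI)

end

theory Submission imports Defs
begin

text \<open>
  A complex structure on a real Lie algebra is the same as a complex subalgebra \<open>\<qq>\<close> of the
  complexification that is complementary to its conjugate: the \<open>\<i>\<close>-eigenspace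
  \<open>{x - \<i> J x}\<close>. The one used here is of Samelson's type. Number coordinates from \<open>0\<close>, put
  \<open>z\<^sub>a = e\<^sub>2\<^sub>a - \<i> e\<^sub>2\<^sub>a\<^sub>+\<^sub>1\<close> and let \<open>\<epsilon>\<^sub>a\<close> be its weight under the Cartan subalgebra of
  \<open>\<ss>\<oo>\<close> spanned by the rotations \<open>H\<^sub>a\<close> of the planes \<open>(e\<^sub>2\<^sub>a, e\<^sub>2\<^sub>a\<^sub>+\<^sub>1)\<close>. With
  \<open>\<epsilon>\<^sub>0 > \<epsilon>\<^sub>1 > \<dots>\<close>, let \<open>\<qq>\<close> be the sum of the positive root spaces of \<open>\<ss>\<oo>\<close>, the translations
  of positive weight, and half of the weight zero space. The positive part is closed under
  brackets and normalized by the weight zero space. The latter is commutative, because it is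
  spanned by the \<open>H\<^sub>a\<close>, the last translation if the dimension is odd, and the central summand. So
  the only constraint is that the weight zero space has even dimension. In \<open>\<ee>(n)\<close> this fails
  exactly for \<open>n \<equiv> 1, 2\<close> modulo \<open>4\<close>, where one central generator repairs it.

  The inclusions become holomorphic when the weight zero spaces are paired compatibly:
  \<open>H\<^sub>2\<^sub>c\<close> goes to \<open>H\<^sub>2\<^sub>c\<^sub>+\<^sub>1\<close> for \<open>c < k\<close>. In dimension \<open>4k + 1\<close> the translation \<open>e\<^sub>4\<^sub>k\<close> goes to
  the centre, which is called \<open>e\<^sub>4\<^sub>k\<^sub>+\<^sub>1\<close>, in agreement with the weight vector \<open>z\<^sub>2\<^sub>k\<close> one dimension
  higher. In dimensions \<open>4k + 2\<close> and \<open>4k + 3\<close> the rotation \<open>H\<^sub>2\<^sub>k\<close> goes to \<open>e\<^sub>4\<^sub>k\<^sub>+\<^sub>2\<close>, which is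
  central in the first case and a translation in the second. Hence all four algebras of one chain
  are \<open>J\<close>-stable subspaces of \<open>\<ee>(4k + 3)\<close> and a single \<open>\<qq>\<close> serves for them
  (\<open>polarized\<close>). To exploit this, every element is described by coordinate functions on all of
  \<open>\<nat>\<close>, with the central coordinate appended to the translation. The inclusions preserve these
  coordinates, and \<open>J x\<close> is characterized by \<open>x - \<i> J x \<in> \<qq>\<close>, so holomorphy is
  immediate (\<open>holomorphic_natural_incl\<close>). The substance is that \<open>\<qq>\<close> is a subalgebra
  (\<open>polarized_bracket\<close>) and is a graph over the real elements (\<open>polarized_iff_J\<close>,
  \<open>J_graph_iff\<close>).
\<close>

section \<open>Complex structures from complex subalgebras\<close>

text \<open>Read \<open>Q x y\<close> as \<open>x - \<i> y \<in> \<qq>\<close>. The hypotheses say that \<open>\<qq>\<close> is a complex subalgebra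
  (\<open>rotate\<close> is multiplication by \<open>\<i>\<close>) that is the graph of \<open>J\<close>. Expanding the bracket of
  \<open>x - \<i> J x\<close> and \<open>y - \<i> J y\<close> then gives
  \<open>J ([x, y] - [J x, J y]) = [x, J y] + [J x, y]\<close>, which is the integrability condition.\<close>

lemma complex_structureI_graph:
  fixes L :: "('a, 'm) lie_scheme" (structure)
  assumes "real_lie_algebra L"
    and J: "\<And>x. x \<in> carrier L \<Longrightarrow> J x \<in> carrier L"
    and graph: "\<And>x y. \<lbrakk>x \<in> carrier L; y \<in> carrier L\<rbrakk> \<Longrightarrow> Q x y \<longleftrightarrow> J x = y"
    and add: "\<And>x y x' y'. \<lbrakk>x \<in> carrier L; y \<in> carrier L; x' \<in> carrier L; y' \<in> carrier L; Q x y; Q x' y'\<rbrakk>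
      \<Longrightarrow> Q (x \<oplus> x') (y \<oplus> y')"
    and smult: "\<And>c x y. \<lbrakk>x \<in> carrier L; y \<in> carrier L; Q x y\<rbrakk> \<Longrightarrow> Q (c \<odot> x) (c \<odot> y)"
    and rotate: "\<And>x y. \<lbrakk>x \<in> carrier L; y \<in> carrier L; Q x y\<rbrakk> \<Longrightarrow> Q y ((-1) \<odot> x)"
    and bracket: "\<And>x y x' y'. \<lbrakk>x \<in> carrier L; y \<in> carrier L; x' \<in> carrier L; y' \<in> carrier L; Q x y; Q x' y'\<rbrakk>
      \<Longrightarrow> Q (lie_bracket L x x' \<oplus> (-1) \<odot> lie_bracket L y y') (lie_bracket L x y' \<oplus> lie_bracket L y x')"
  shows "complex_structure L J"
proof -
  interpret real_lie_algebra L by fact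
  have sm: "c \<odot> x \<in> carrier L" if "x \<in> carrier L" for c :: real and x
    using that by (intro smult_closed) (auto simp: class_ring_simps)
  have neg: "(-1) \<odot> x = \<ominus> x" if "x \<in> carrier L" for x
  proof (rule M.minus_equality[symmetric])
    show "(-1) \<odot> x \<oplus> x = \<zero>"
      using smult_l_distr[of "-1" 1 x] lmult_0[OF that] smult_one[OF that] that
      by (simp add: class_ring_simps)
  qed (use that sm in auto)
  have Q: "Q x (J x)" if "x \<in> carrier L" for x
    using graph[OF that J[OF that]] by simp
  have J_add: "J (x \<oplus> y) = J x \<oplus> J y" if "x \<in> carrier L" "y \<in> carrier L" for x y
    using graph[of "x \<oplus> y" "J x \<oplus> J y"] add[OF that(1) J[OF that(1)] that(2) J[OF that(2)] Q Q] that J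
    by auto
  have J_smult: "J (c \<odot> x) = c \<odot> J x" if "x \<in> carrier L" for c x
    using graph[of "c \<odot> x" "c \<odot> J x"] smult[OF that J[OF that] Q] that J sm by auto
  have "J \<in> LinearCombinations.module_hom class_ring L L"
    unfolding LinearCombinations.module_hom_def using J J_add J_smult by auto
  then have lin: "linear_map class_ring L L J"
    by (intro linear_map.intro mod_hom.intro mod_hom_axioms.intro vectorspace_axioms module_axioms)
  show ?thesis
  proof (intro complex_structure.intro complex_structure_axioms.intro lin assms(1), goal_cases)
    case (1 x)
    then show ?case using graph[of "J x" "(-1) \<odot> x"] rotate[OF 1 J[OF 1] Q] J sm neg by auto
  next
    case (2 x y)
    let ?b = "lie_bracket L"
    note c [simp] = 2 J[OF 2(1)] J[OF 2(2)]
    have [simp]: "?b x y \<in> carrier L" "?b (J x) y \<in> carrier L" "?b x (J y) \<in> carrier L"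
      "?b (J x) (J y) \<in> carrier L" by (simp_all add: bracket_closed)
    have "J (?b x y \<oplus> (-1) \<odot> ?b (J x) (J y)) = ?b x (J y) \<oplus> ?b (J x) y"
      using bracket[OF c(1,3) c(2,4) Q[OF c(1)] Q[OF c(2)]] graph sm by simp
    then have "J (?b x y) \<ominus> J (?b (J x) (J y)) = ?b x (J y) \<oplus> ?b (J x) y"
      using J_smult[of "?b (J x) (J y)" "-1"] by (simp add: J_add neg J a_minus_def)
    moreover have "a \<ominus> e \<ominus> d \<ominus> b = (a \<ominus> b) \<ominus> (d \<oplus> e)"
      if "a \<in> carrier L" "b \<in> carrier L" "d \<in> carrier L" "e \<in> carrier L" for a b d e
      using that by (simp add: a_minus_def M.minus_add M.a_ac)
    ultimately show ?case using J by (simp add: a_minus_def M.r_neg)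
  qed
qed

section \<open>Coordinates common to all the algebras\<close>

definition rot_coord :: "real vec \<times> real mat \<times> real vec \<Rightarrow> nat \<Rightarrow> nat \<Rightarrow> real" where
  "rot_coord = (\<lambda>(t, A, u) p q. if p < dim_row A \<and> q < dim_col A then A $$ (p, q) else 0)"

text \<open>The central coordinate follows the translation coordinates, as the natural inclusions send
  the central generator to the next standard translation.\<close>

definition tra_coord :: "real vec \<times> real mat \<times> real vec \<Rightarrow> nat \<Rightarrow> real" where
  "tra_coord = (\<lambda>(t, A, u) p. if p < dim_vec u + dim_vec t then (u @\<^sub>v t) $ p else 0)"

lemma skew_entry:
  assumes "A \<in> carrier_mat n n" "transpose_mat A = - (A :: real mat)" "p < n" "q < n"
  shows "A $$ (q, p) = - A $$ (p, q)"
  using arg_cong[OF assms(2), of "\<lambda>M. M $$ (p, q)"] assms(1,3,4) by simp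

lemma rot_coord_skew: "x \<in> carrier (ext_euclid s n) \<Longrightarrow> rot_coord x q p = - rot_coord x p q"
  by (cases x) (auto simp: rot_coord_def intro: skew_entry)

lemma rot_coord_eq_0: "\<lbrakk>x \<in> carrier (ext_euclid s n); n \<le> p \<or> n \<le> q\<rbrakk> \<Longrightarrow> rot_coord x p q = 0"
  by (cases x) (auto simp: rot_coord_def)

lemma tra_coord_eq_0: "\<lbrakk>x \<in> carrier (ext_euclid s n); n + s \<le> p\<rbrakk> \<Longrightarrow> tra_coord x p = 0"
  by (cases x) (auto simp: tra_coord_def)

lemma coordinates_inject:
  assumes x: "x \<in> carrier (ext_euclid s n)" and y: "y \<in> carrier (ext_euclid s n)"
    and "rot_coord x = rot_coord y" "tra_coord x = tra_coord y"
  shows "x = y"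
proof -
  obtain t A u t' B v where xy: "x = (t, A, u)" "y = (t', B, v)" by (cases x, cases y) auto
  have c: "A \<in> carrier_mat n n" "B \<in> carrier_mat n n" "u \<in> carrier_vec n" "v \<in> carrier_vec n"
    "t \<in> carrier_vec s" "t' \<in> carrier_vec s"
    using x y by (auto simp: xy)
  have "A = B"
  proof (rule eq_matI)
    fix i j assume "i < dim_row B" "j < dim_col B"
    then show "A $$ (i, j) = B $$ (i, j)"
      using fun_cong[OF fun_cong[OF assms(3)], of i j] c by (simp add: rot_coord_def xy)
  qed (use c in auto)
  moreover have "u @\<^sub>v t = v @\<^sub>v t'"
  proof (rule eq_vecI)
    fix i assume "i < dim_vec (v @\<^sub>v t')"
    then show "(u @\<^sub>v t) $ i = (v @\<^sub>v t') $ i"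
      using fun_cong[OF assms(4), of i] c by (simp add: tra_coord_def xy)
  qed (use c in auto)
  ultimately show ?thesis using append_vec_eq[OF c(3,4)] by (simp add: xy)
qed

lemma rot_coord_add:
  "\<lbrakk>x \<in> carrier (ext_euclid s n); y \<in> carrier (ext_euclid s n)\<rbrakk>
    \<Longrightarrow> rot_coord (x \<oplus>\<^bsub>ext_euclid s n\<^esub> y) p q = rot_coord x p q + rot_coord y p q"
  by (cases x, cases y) (auto simp: rot_coord_def)

lemma tra_coord_add:
  "\<lbrakk>x \<in> carrier (ext_euclid s n); y \<in> carrier (ext_euclid s n)\<rbrakk>
    \<Longrightarrow> tra_coord (x \<oplus>\<^bsub>ext_euclid s n\<^esub> y) p = tra_coord x p + tra_coord y p"
  by (cases x, cases y) (auto simp: tra_coord_def append_vec_def)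

lemma rot_coord_smult:
  "x \<in> carrier (ext_euclid s n) \<Longrightarrow> rot_coord (c \<odot>\<^bsub>ext_euclid s n\<^esub> x) p q = c * rot_coord x p q"
  by (cases x) (auto simp: rot_coord_def)

lemma tra_coord_smult:
  "x \<in> carrier (ext_euclid s n) \<Longrightarrow> tra_coord (c \<odot>\<^bsub>ext_euclid s n\<^esub> x) p = c * tra_coord x p"
  by (cases x) (auto simp: tra_coord_def append_vec_def)

text \<open>The summation range \<open>N\<close> may exceed \<open>n\<close>, so that all algebras of a chain share the bracket
  formula of the largest one. Central coordinates do not enter, because \<open>rot_coord\<close> vanishes
  outside the leading \<open>n \<times> n\<close> block.\<close>

lemma rot_coord_bracket:
  assumes x: "x \<in> carrier (ext_euclid s n)" and y: "y \<in> carrier (ext_euclid s n)" and N: "n \<le> N"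
  shows "rot_coord (lie_bracket (ext_euclid s n) x y) p q
    = (\<Sum>r<N. rot_coord x p r * rot_coord y r q - rot_coord y p r * rot_coord x r q)"
proof -
  obtain t A u t' B v where xy: "x = (t, A, u)" "y = (t', B, v)" by (cases x, cases y) auto
  have c: "A \<in> carrier_mat n n" "B \<in> carrier_mat n n"
    using x y by (auto simp: xy)
  have "(\<Sum>r<N. rot_coord x p r * rot_coord y r q - rot_coord y p r * rot_coord x r q)
      = (\<Sum>r<n. rot_coord x p r * rot_coord y r q - rot_coord y p r * rot_coord x r q)"
    using N x y by (intro sum.mono_neutral_right) (auto simp: rot_coord_eq_0)
  also have "\<dots> = rot_coord (lie_bracket (ext_euclid s n) x y) p q"
    using c by (auto simp: xy rot_coord_def scalar_prod_def sum_subtractf atLeast0LessThan)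
  finally show ?thesis ..
qed

lemma tra_coord_bracket:
  assumes x: "x \<in> carrier (ext_euclid s n)" and y: "y \<in> carrier (ext_euclid s n)" and N: "n \<le> N"
  shows "tra_coord (lie_bracket (ext_euclid s n) x y) p
    = (\<Sum>r<N. rot_coord x p r * tra_coord y r - rot_coord y p r * tra_coord x r)"
proof -
  obtain t A u t' B v where xy: "x = (t, A, u)" "y = (t', B, v)" by (cases x, cases y) auto
  have c: "A \<in> carrier_mat n n" "B \<in> carrier_mat n n" "u \<in> carrier_vec n" "v \<in> carrier_vec n"
    using x y by (auto simp: xy)
  have "(\<Sum>r<N. rot_coord x p r * tra_coord y r - rot_coord y p r * tra_coord x r)
      = (\<Sum>r<n. rot_coord x p r * tra_coord y r - rot_coord y p r * tra_coord x r)"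
    using N x y by (intro sum.mono_neutral_right) (auto simp: rot_coord_eq_0)
  also have "\<dots> = tra_coord (lie_bracket (ext_euclid s n) x y) p"
    using c by (auto simp: xy rot_coord_def tra_coord_def scalar_prod_def sum_subtractf atLeast0LessThan
        append_vec_def)
  finally show ?thesis ..
qed

lemma rot_coord_natural_incl:
  "x \<in> carrier (ext_euclid s n) \<Longrightarrow> rot_coord (natural_incl s s' n x) = rot_coord x"
  by (cases x) (auto simp: rot_coord_def natural_incl_def pad_mat_def fun_eq_iff)

lemma tra_coord_natural_incl:
  "x \<in> carrier (ext_euclid s n) \<Longrightarrow> tra_coord (natural_incl s s' n x) = tra_coord x"
  by (cases x) (auto simp: tra_coord_def natural_incl_def append_vec_def Let_def fun_eq_iff)

section \<open>The complex subalgebra\<close>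

text \<open>The subalgebra \<open>\<qq>\<close> in coordinates, where \<open>F\<close> is the complex skew matrix and \<open>G\<close> the complex
  translation. The second and third condition say that the coefficients involving
  \<open>e\<^sub>2\<^sub>a\<close> and \<open>e\<^sub>2\<^sub>a\<^sub>+\<^sub>1\<close> combine to multiples of \<open>z\<^sub>a \<and> e\<^sub>q\<close> and of \<open>z\<^sub>a\<close>, that is, only
  positive weights occur. The last two describe the half of the weight zero space.\<close>

definition polarized :: "nat \<Rightarrow> (nat \<Rightarrow> nat \<Rightarrow> complex) \<Rightarrow> (nat \<Rightarrow> complex) \<Rightarrow> bool" where
  "polarized k F G \<longleftrightarrow>
     (\<forall>p q. F q p = - F p q) \<and>
     (\<forall>a\<le>2 * k. \<forall>q\<ge>2 * a + 2. F (2 * a + 1) q = - \<i> * F (2 * a) q) \<and>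
     (\<forall>a\<le>2 * k. G (2 * a + 1) = - \<i> * G (2 * a)) \<and>
     (\<forall>c<k. F (4 * c + 2) (4 * c + 3) = - \<i> * F (4 * c) (4 * c + 1)) \<and>
     G (4 * k + 2) = - \<i> * F (4 * k) (4 * k + 1)"

lemma
  assumes "polarized k F G"
  shows polarized_skew: "F q p = - F p q"
    and polarized_row: "\<lbrakk>a \<le> 2 * k; 2 * a + 2 \<le> q\<rbrakk> \<Longrightarrow> F (2 * a + 1) q = - \<i> * F (2 * a) q"
    and polarized_tra: "a \<le> 2 * k \<Longrightarrow> G (2 * a + 1) = - \<i> * G (2 * a)"
    and polarized_cartan: "c < k \<Longrightarrow> F (4 * c + 2) (4 * c + 3) = - \<i> * F (4 * c) (4 * c + 1)"
    and polarized_last: "G (4 * k + 2) = - \<i> * F (4 * k) (4 * k + 1)"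
  using assms unfolding polarized_def by blast+

lemma polarized_add:
  assumes F: "polarized k F G" and F': "polarized k F' G'"
  shows "polarized k (\<lambda>p q. F p q + F' p q) (\<lambda>p. G p + G' p)"
  unfolding polarized_def
proof (intro conjI allI impI, goal_cases)
  case (1 p q)
  show ?case using polarized_skew[OF F, of q p] polarized_skew[OF F', of q p] by simp
qed (simp_all only: polarized_row[OF F] polarized_row[OF F'] polarized_tra[OF F]
      polarized_tra[OF F'] polarized_cartan[OF F] polarized_cartan[OF F'] polarized_last[OF F] polarized_last[OF F'] ring_distribs)

lemma polarized_scale:
  assumes F: "polarized k F G"
  shows "polarized k (\<lambda>p q. z * F p q) (\<lambda>p. z * G p)"
  unfolding polarized_def
proof (intro conjI allI impI, goal_cases)
  case (1 p q)
  show ?case using polarized_skew[OF F, of q p] by simp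
qed (simp_all only: polarized_row[OF F] polarized_tra[OF F] polarized_cartan[OF F]
      polarized_last[OF F] mult.left_commute)

text \<open>Here \<open>f\<close> and \<open>g\<close> are combinations of the \<open>z\<^sub>b\<close>, and these span a totally isotropic space
  for the bilinear form, since \<open>z\<^sub>b \<bullet> z\<^sub>b = 1 + (- \<i>)\<^sup>2 = 0\<close>.\<close>

lemma isotropic_sum_eq_0:
  fixes f g :: "nat \<Rightarrow> complex"
  assumes "\<And>b. b < a \<Longrightarrow> f (2 * b + 1) = - \<i> * f (2 * b)"
    and "\<And>b. b < a \<Longrightarrow> g (2 * b + 1) = - \<i> * g (2 * b)"
  shows "(\<Sum>r<2 * a. f r * g r) = 0"
  using assms by (induction a) (auto simp: algebra_simps)

lemma polarized_left_columns:
  assumes "polarized k F G" "b \<le> 2 * k" "2 * b + 2 \<le> p"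
  shows "F p (2 * b + 1) = - \<i> * F p (2 * b)"
proof -
  have "F p (2 * b + 1) = - F (2 * b + 1) p" "F p (2 * b) = - F (2 * b) p"
    "F (2 * b + 1) p = - \<i> * F (2 * b) p"
    by (rule polarized_skew[OF assms(1)] polarized_row[OF assms])+
  then show ?thesis by simp
qed

lemma sum_split_pair:
  fixes h :: "nat \<Rightarrow> complex"
  assumes "a \<le> 2 * k"
  shows "(\<Sum>r<4 * k + 3. h r)
    = (\<Sum>r<2 * a. h r) + h (2 * a) + h (2 * a + 1) + (\<Sum>r=2 * a + 2..<4 * k + 3. h r)"
proof -
  have "(\<Sum>r<4 * k + 3. h r) = (\<Sum>r<2 * a + 2. h r) + (\<Sum>r=2 * a + 2..<4 * k + 3. h r)"
    unfolding lessThan_atLeast0 using assms by (subst sum.atLeastLessThan_concat) auto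
  then show ?thesis by simp
qed

text \<open>Elements of \<open>\<qq>\<close> act on column vectors as a Borel subalgebra of \<open>\<ss>\<oo>\<close> does: being of
  positive weight in the planes \<open>0, \<dots>, a\<close> is inherited in plane \<open>a\<close>. In the sum, the planes below \<open>a\<close>
  contribute \<open>0\<close> by isotropy, \<open>z\<^sub>a\<close> is an eigenvector of the rotation \<open>H\<^sub>a\<close>, and beyond plane \<open>a\<close>
  the two rows of \<open>F\<close> are proportional. Columns of matrices in \<open>\<qq>\<close> and translations in \<open>\<qq>\<close> are
  both admissible as \<open>g\<close>.\<close>

lemma polarized_preserves_flag:
  assumes F: "polarized k F G" and a: "a \<le> 2 * k"
    and g: "\<And>b. b \<le> a \<Longrightarrow> g (2 * b + 1) = - \<i> * g (2 * b)"
  shows "(\<Sum>r<4 * k + 3. F (2 * a + 1) r * g r) = - \<i> * (\<Sum>r<4 * k + 3. F (2 * a) r * g r)"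
proof -
  have low: "(\<Sum>r<2 * a. F p r * g r) = 0" if "2 * a \<le> p" for p
    using that a g by (intro isotropic_sum_eq_0 polarized_left_columns[OF F]) auto
  have high: "(\<Sum>r=2 * a + 2..<4 * k + 3. F (2 * a + 1) r * g r)
      = - \<i> * (\<Sum>r=2 * a + 2..<4 * k + 3. F (2 * a) r * g r)"
    using a by (simp add: polarized_row[OF F, simplified] sum_distrib_left mult.assoc)
  note skew = polarized_skew[OF F]
  have "F (2 * a) (2 * a) = 0" "F (2 * a + 1) (2 * a + 1) = 0"
    using skew[of "2 * a" "2 * a"] skew[of "2 * a + 1" "2 * a + 1"] by simp_all
  then show ?thesis
    unfolding sum_split_pair[OF a] low[OF order_refl] low[of "2 * a + 1", OF le_add1] high
    using g[of a] skew[of "2 * a" "2 * a + 1"] by (simp add: algebra_simps)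
qed

text \<open>The commutator has no component along the Cartan subalgebra: opposite roots are never both
  positive. In coordinates, the planes below \<open>a\<close> vanish by isotropy and the terms beyond plane
  \<open>a\<close> are symmetric in \<open>F\<close> and \<open>F'\<close>.\<close>

lemma polarized_bracket_diagonal:
  assumes F: "polarized k F G" and F': "polarized k F' G'" and a: "a \<le> 2 * k"
  shows "(\<Sum>r<4 * k + 3. F (2 * a) r * F' r (2 * a + 1) - F' (2 * a) r * F r (2 * a + 1)) = 0"
proof -
  note skew = polarized_skew[OF F] polarized_skew[OF F']
  have diag: "F p p = 0" "F' p p = 0" for p
    using skew(1)[of p p] skew(2)[of p p] by simp_all
  have low: "(\<Sum>r<2 * a. F (2 * a) r * F' r (2 * a + 1)) = 0" "(\<Sum>r<2 * a. F' (2 * a) r * F r (2 * a + 1)) = 0"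
    by (rule isotropic_sum_eq_0;
        use a in \<open>simp add: polarized_left_columns[OF F, simplified] polarized_left_columns[OF F', simplified]
          polarized_row[OF F, simplified] polarized_row[OF F', simplified]\<close>)+
  have "F (2 * a) r * F' r (2 * a + 1) = F' (2 * a) r * F r (2 * a + 1)" if "2 * a + 2 \<le> r" for r
  proof -
    have "F (2 * a + 1) r = - \<i> * F (2 * a) r" "F' (2 * a + 1) r = - \<i> * F' (2 * a) r"
      by (rule polarized_row[OF F a that] polarized_row[OF F' a that])+
    then show ?thesis using skew(1)[of r "2 * a + 1"] skew(2)[of r "2 * a + 1"] by simp
  qed
  then show ?thesis
    unfolding sum_split_pair[OF a] by (simp add: low[simplified] sum_subtractf diag)
qed

text \<open>Positivity of the weights follows from \<open>polarized_preserves_flag\<close>, applied to the columns of the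
  matrices and to the translations. The weight zero conditions hold trivially, since the Cartan
  components and the last translation component of a bracket are zero.\<close>

lemma polarized_bracket:
  assumes F: "polarized k F G" and F': "polarized k F' G'"
  shows "polarized k (\<lambda>p q. \<Sum>r<4 * k + 3. F p r * F' r q - F' p r * F r q)
    (\<lambda>p. \<Sum>r<4 * k + 3. F p r * G' r - F' p r * G r)"
proof -
  note skew = polarized_skew[OF F] polarized_skew[OF F']
  have 1: "(\<Sum>r<4 * k + 3. F q r * F' r p - F' q r * F r p)
      = - (\<Sum>r<4 * k + 3. F p r * F' r q - F' p r * F r q)" for p q
    unfolding sum_negf[symmetric]
  proof (rule sum.cong)
    fix r
    show "F q r * F' r p - F' q r * F r p = - (F p r * F' r q - F' p r * F r q)"
      using skew(1)[of q r] skew(2)[of q r] skew(1)[of r p] skew(2)[of r p] by simp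
  qed simp
  have 2: "(\<Sum>r<4 * k + 3. F (2 * a + 1) r * F' r q - F' (2 * a + 1) r * F r q)
      = - \<i> * (\<Sum>r<4 * k + 3. F (2 * a) r * F' r q - F' (2 * a) r * F r q)"
    if a: "a \<le> 2 * k" and q: "2 * a + 2 \<le> q" for a q
  proof -
    have "F (2 * b + 1) q = - \<i> * F (2 * b) q" "F' (2 * b + 1) q = - \<i> * F' (2 * b) q" if "b \<le> a" for b
      using polarized_row[OF F, of b q] polarized_row[OF F', of b q] a q that by simp_all
    then show ?thesis
      using polarized_preserves_flag[OF F a, of "\<lambda>r. F' r q"] polarized_preserves_flag[OF F' a, of "\<lambda>r. F r q"]
      by (simp add: sum_subtractf right_diff_distrib)
  qed
  have G: "G (2 * a + 1) = - \<i> * G (2 * a)" "G' (2 * a + 1) = - \<i> * G' (2 * a)" if "a \<le> 2 * k" for a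
    using polarized_tra[OF F that] polarized_tra[OF F' that] by simp_all
  have 3: "(\<Sum>r<4 * k + 3. F (2 * a + 1) r * G' r - F' (2 * a + 1) r * G r)
      = - \<i> * (\<Sum>r<4 * k + 3. F (2 * a) r * G' r - F' (2 * a) r * G r)"
    if a: "a \<le> 2 * k" for a
    using polarized_preserves_flag[OF F a, of G'] polarized_preserves_flag[OF F' a, of G] G a
    by (simp add: sum_subtractf right_diff_distrib)
  have 4: "(\<Sum>r<4 * k + 3. F (4 * k + 2) r * G' r - F' (4 * k + 2) r * G r) = 0"
  proof -
    have "(\<Sum>r<2 * (2 * k + 1). F (4 * k + 2) r * G' r) = 0" "(\<Sum>r<2 * (2 * k + 1). F' (4 * k + 2) r * G r) = 0"
      by (rule isotropic_sum_eq_0;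
        use G in \<open>simp add: polarized_left_columns[OF F, simplified] polarized_left_columns[OF F', simplified]\<close>)+
    moreover have "F (4 * k + 2) (4 * k + 2) = 0" "F' (4 * k + 2) (4 * k + 2) = 0"
      using skew(1)[of "4 * k + 2" "4 * k + 2"] skew(2)[of "4 * k + 2" "4 * k + 2"] by simp_all
    moreover have "{..<4 * k + 3} = insert (4 * k + 2) {..<2 * (2 * k + 1)}" by auto
    ultimately show ?thesis by (simp add: sum_subtractf)
  qed
  have 5: "(\<Sum>r<4 * k + 3. F (4 * c) r * F' r (4 * c + 1) - F' (4 * c) r * F r (4 * c + 1)) = 0"
    if "c \<le> k" for c
    using polarized_bracket_diagonal[OF F F', of "2 * c"] that by simp
  have 6: "(\<Sum>r<4 * k + 3. F (4 * c + 2) r * F' r (4 * c + 3) - F' (4 * c + 2) r * F r (4 * c + 3)) = 0"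
    if "c < k" for c
    using polarized_bracket_diagonal[OF F F', of "2 * c + 1"] that by (simp add: numeral_3_eq_3)
  show ?thesis
    unfolding polarized_def
  proof (intro conjI allI impI)
    fix p q
    show "(\<Sum>r<4 * k + 3. F q r * F' r p - F' q r * F r p)
      = - (\<Sum>r<4 * k + 3. F p r * F' r q - F' p r * F r q)" by (rule 1)
  qed (simp_all only: 2 3 4 5 6 less_imp_le order_refl mult_zero_right)
qed

section \<open>The complex structure\<close>

text \<open>The entries of the matrix part of \<open>J\<close> above the diagonal. The first two cases turn \<open>e\<^sub>2\<^sub>a\<close>
  into \<open>e\<^sub>2\<^sub>a\<^sub>+\<^sub>1\<close> in \<open>e\<^sub>p \<and> e\<^sub>q\<close>, for \<open>q\<close> in a later plane than \<open>p\<close>. The remaining ones are the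
  coefficients of the plane rotations \<open>H\<^sub>a\<close>, with \<open>p = 2a\<close>: \<open>H\<^sub>2\<^sub>k\<close> is paired with the translation
  \<open>e\<^sub>4\<^sub>k\<^sub>+\<^sub>2\<close>, and \<open>H\<^sub>2\<^sub>c\<close> with \<open>H\<^sub>2\<^sub>c\<^sub>+\<^sub>1\<close>. No plane with \<open>p > 4k\<close> occurs in \<open>\<ee>(4k + 3)\<close>.\<close>

definition J_upper :: "nat \<Rightarrow> (nat \<Rightarrow> nat \<Rightarrow> real) \<Rightarrow> (nat \<Rightarrow> real) \<Rightarrow> nat \<Rightarrow> nat \<Rightarrow> real" where
  "J_upper k F G p q =
     (if odd p then F (p - 1) q
      else if q \<noteq> p + 1 then - F (p + 1) q
      else if 4 * k < p then 0
      else if p = 4 * k then - G (4 * k + 2)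
      else if 4 dvd p then - F (p + 2) (p + 3)
      else F (p - 2) (p - 1))"

definition J_rot :: "nat \<Rightarrow> (nat \<Rightarrow> nat \<Rightarrow> real) \<Rightarrow> (nat \<Rightarrow> real) \<Rightarrow> nat \<Rightarrow> nat \<Rightarrow> real" where
  "J_rot k F G p q =
     (if p < q then J_upper k F G p q else if q < p then - J_upper k F G q p else 0)"

definition J_tra :: "nat \<Rightarrow> (nat \<Rightarrow> nat \<Rightarrow> real) \<Rightarrow> (nat \<Rightarrow> real) \<Rightarrow> nat \<Rightarrow> real" where
  "J_tra k F G p =
     (if p < 4 * k + 2 then (if even p then - G (p + 1) else G (p - 1))
      else if p = 4 * k + 2 then F (4 * k) (4 * k + 1) else 0)"

text \<open>The elements of \<open>\<qq>\<close> are exactly the \<open>x - \<i> J x\<close>: separating real and imaginary parts, each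
  condition \<open>w' = - \<i> w\<close> defining \<open>\<qq>\<close> determines the imaginary parts of \<open>w\<close> and \<open>w'\<close> by the
  real parts, and up to skew symmetry every coordinate of \<open>\<ee>(4k + 3)\<close> occurs in exactly one of them.\<close>

lemma polarized_iff_J:
  assumes skew: "\<And>p q. F q p = - F p q" "\<And>p q. F' q p = - F' p q"
    and supp: "\<And>p q. 4 * k + 3 \<le> q \<Longrightarrow> F p q = 0" "\<And>p q. 4 * k + 3 \<le> q \<Longrightarrow> F' p q = 0"
      "\<And>p. 4 * k + 3 \<le> p \<Longrightarrow> G' p = 0"
  shows "polarized k (\<lambda>p q. Complex (F p q) (- F' p q)) (\<lambda>p. Complex (G p) (- G' p))
    \<longleftrightarrow> F' = J_rot k F G \<and> G' = J_tra k F G" (is "?L \<longleftrightarrow> ?R")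
proof
  assume L: ?L
  have row: "F (2 * a + 1) q = - F' (2 * a) q" "F' (2 * a + 1) q = F (2 * a) q"
    if "a \<le> 2 * k" "2 * a + 2 \<le> q" for a q
    using polarized_row[OF L that] by (simp_all add: complex_eq_iff)
  have tra: "G (2 * a + 1) = - G' (2 * a)" "G' (2 * a + 1) = G (2 * a)" if "a \<le> 2 * k" for a
    using polarized_tra[OF L that] by (simp_all add: complex_eq_iff)
  have diag: "F (4 * c + 2) (4 * c + 3) = - F' (4 * c) (4 * c + 1)"
    "F' (4 * c + 2) (4 * c + 3) = F (4 * c) (4 * c + 1)" if "c < k" for c
    using polarized_cartan[OF L that] by (simp_all add: complex_eq_iff)
  have last: "G (4 * k + 2) = - F' (4 * k) (4 * k + 1)" "G' (4 * k + 2) = F (4 * k) (4 * k + 1)"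
    using polarized_last[OF L] by (simp_all add: complex_eq_iff)
  have upper: "F' p q = J_upper k F G p q" if "p < q" for p q
  proof (cases "4 * k + 3 \<le> q")
    case True
    then show ?thesis using that supp by (auto simp: J_upper_def)
  next
    case False
    show ?thesis
    proof (cases "odd p")
      case True
      then obtain a where "p = 2 * a + 1" by (rule oddE)
      then show ?thesis using row[of a q] False that by (simp add: J_upper_def)
    next
      case even: False
      then obtain a where a: "p = 2 * a" by auto
      show ?thesis
      proof (cases "q = p + 1")
        case False
        then show ?thesis using row[of a q] \<open>\<not> 4 * k + 3 \<le> q\<close> that a by (simp add: J_upper_def)
      next
        case q: True
        show ?thesis
        proof (cases "even a")
          case True
          then obtain c where c: "a = 2 * c" by auto
          then show ?thesis using diag[of c] last q False a by (cases "c = k") (auto simp: J_upper_def)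
        next
          case odd: False
          then obtain c where c: "a = 2 * c + 1" by (rule oddE)
          have nd: "\<not> 4 dvd (4 * c + 2)" by presburger
          have "F' p q = F (4 * c) (4 * c + 1)"
            using diag(2)[of c] q False a c by (simp add: numeral_3_eq_3)
          then show ?thesis using q False a c nd by (auto simp: J_upper_def)
        qed
      qed
    qed
  qed
  have "F' p q = J_rot k F G p q" for p q
    using upper[of p q] upper[of q p] skew(2)[of p q] skew(2)[of p p] by (auto simp: J_rot_def not_less_iff_gr_or_eq)
  moreover have "G' p = J_tra k F G p" for p
  proof (cases "p < 4 * k + 2")
    case True
    then show ?thesis using tra[of "p div 2"] by (cases "even p") (auto simp: J_tra_def elim!: oddE)
  next
    case False
    then show ?thesis using last supp(3)[of p] by (auto simp: J_tra_def)
  qed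
  ultimately show ?R by auto
next
  assume R: ?R
  have d: "\<not> 4 dvd Suc (Suc (4 * c))" for c :: nat by presburger
  have F': "F' = J_rot k F G" and G': "G' = J_tra k F G" using R by auto
  show ?L
    unfolding polarized_def
  proof (intro conjI allI impI, goal_cases)
    case (1 p q)
    show ?case using skew(1)[of q p] skew(2)[of q p] by (simp add: complex_eq_iff)
  qed (auto simp: F' G' complex_eq_iff J_rot_def J_tra_def J_upper_def d numeral_3_eq_3)
qed

definition J_ext :: "nat \<Rightarrow> nat \<Rightarrow> nat \<Rightarrow> real vec \<times> real mat \<times> real vec \<Rightarrow> real vec \<times> real mat \<times> real vec"
  where
  "J_ext k s n x =
     (vec s (\<lambda>i. J_tra k (rot_coord x) (tra_coord x) (n + i)),
      mat n n (\<lambda>(p, q). J_rot k (rot_coord x) (tra_coord x) p q),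
      vec n (J_tra k (rot_coord x) (tra_coord x)))"

text \<open>The algebras \<open>\<real>\<^sup>s \<oplus> \<ee>(n)\<close> occurring in the \<open>k\<close>-th chain.\<close>

definition admissible :: "nat \<Rightarrow> nat \<Rightarrow> nat \<Rightarrow> bool" where
  "admissible k s n \<longleftrightarrow> (s, n) \<in> {(0, 4 * k), (1, 4 * k + 1), (1, 4 * k + 2), (0, 4 * k + 3)}"

lemma J_rot_skew: "J_rot k F G q p = - J_rot k F G p q"
  by (auto simp: J_rot_def)

lemma J_ext_closed: "J_ext k s n x \<in> carrier (ext_euclid s n)"
proof -
  let ?A = "mat n n (\<lambda>(p, q). J_rot k (rot_coord x) (tra_coord x) p q)"
  have "transpose_mat ?A = - ?A"
    by (rule eq_matI) (simp_all add: J_rot_skew[symmetric])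
  then show ?thesis by (simp add: J_ext_def)
qed

text \<open>The coordinates of \<open>\<real>\<^sup>s \<oplus> \<ee>(n)\<close> are a \<open>J\<close>-stable subspace of those of \<open>\<ee>(4k + 3)\<close>, so
  nothing is lost in \<open>J_ext\<close> by cutting off at \<open>n\<close> and \<open>n + s\<close>. This is where the choice of \<open>s\<close>
  enters: a pair of coordinates exchanged by \<open>J\<close> must be entirely present or entirely absent.\<close>

lemma
  assumes adm: "admissible k s n" and x: "x \<in> carrier (ext_euclid s n)"
  shows rot_J_ext: "rot_coord (J_ext k s n x) = J_rot k (rot_coord x) (tra_coord x)"
    and tra_J_ext: "tra_coord (J_ext k s n x) = J_tra k (rot_coord x) (tra_coord x)"
proof -
  have u: "J_upper k (rot_coord x) (tra_coord x) p q = 0" if "p < q" "n \<le> q" for p q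
    using that adm rot_coord_eq_0[OF x] tra_coord_eq_0[OF x] by (auto simp: J_upper_def admissible_def)
  have "J_rot k (rot_coord x) (tra_coord x) p q = 0" if "n \<le> p \<or> n \<le> q" for p q
    using that u[of p q] u[of q p] by (auto simp: J_rot_def)
  then show "rot_coord (J_ext k s n x) = J_rot k (rot_coord x) (tra_coord x)"
    by (auto simp: J_ext_def rot_coord_def fun_eq_iff)
  have "J_tra k (rot_coord x) (tra_coord x) p = 0" if "n + s \<le> p" for p
  proof -
    \<comment> \<open>The number \<open>n + s\<close> of translation coordinates is even if it is at most \<open>4k + 2\<close>, so the
      partner \<open>p - 1\<close> of an odd \<open>p\<close> outside the range is outside too.\<close>
    have "n + s \<le> p - 1" if "odd p" "p < 4 * k + 2"
      using that \<open>n + s \<le> p\<close> adm unfolding admissible_def by auto presburger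
    then show ?thesis
      using that adm rot_coord_eq_0[OF x] tra_coord_eq_0[OF x] by (auto simp: J_tra_def admissible_def)
  qed
  then show "tra_coord (J_ext k s n x) = J_tra k (rot_coord x) (tra_coord x)"
    by (auto simp: J_ext_def tra_coord_def fun_eq_iff append_vec_def)
qed

definition J_graph ::
    "nat \<Rightarrow> real vec \<times> real mat \<times> real vec \<Rightarrow> real vec \<times> real mat \<times> real vec \<Rightarrow> bool" where
  "J_graph k x y \<longleftrightarrow>
     polarized k (\<lambda>p q. Complex (rot_coord x p q) (- rot_coord y p q))
       (\<lambda>p. Complex (tra_coord x p) (- tra_coord y p))"

lemma J_graph_iff:
  assumes adm: "admissible k s n" and x: "x \<in> carrier (ext_euclid s n)" and y: "y \<in> carrier (ext_euclid s n)"
  shows "J_graph k x y \<longleftrightarrow> J_ext k s n x = y"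
proof -
  have n: "n + s \<le> 4 * k + 3" using adm by (auto simp: admissible_def)
  have "J_graph k x y \<longleftrightarrow>
      rot_coord y = J_rot k (rot_coord x) (tra_coord x) \<and>
      tra_coord y = J_tra k (rot_coord x) (tra_coord x)"
    unfolding J_graph_def
    using n by (intro polarized_iff_J rot_coord_skew[OF x] rot_coord_skew[OF y] rot_coord_eq_0[OF x]
        rot_coord_eq_0[OF y] tra_coord_eq_0[OF y]) auto
  also have "\<dots> \<longleftrightarrow> J_ext k s n x = y"
    using coordinates_inject[OF J_ext_closed y, of k x] rot_J_ext[OF adm x] tra_J_ext[OF adm x] by auto
  finally show ?thesis .
qed

lemma smult_ext_euclid_closed:
  assumes "x \<in> carrier (ext_euclid s n)"
  shows "c \<odot>\<^bsub>ext_euclid s n\<^esub> x \<in> carrier (ext_euclid s n)"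
proof -
  interpret real_lie_algebra "ext_euclid s n" by (rule lie_algebra_ext_euclid)
  have "c \<in> carrier class_ring" by (simp add: class_ring_simps)
  then show ?thesis using assms by (rule smult_closed)
qed

lemma complex_structure_J_ext:
  assumes adm: "admissible k s n"
  shows "complex_structure (ext_euclid s n) (J_ext k s n)"
proof -
  let ?L = "ext_euclid s n"
  have n: "n \<le> 4 * k + 3" using adm by (auto simp: admissible_def)
  note sm = smult_ext_euclid_closed
  note bracket_closed = real_lie_algebra.bracket_closed[OF lie_algebra_ext_euclid]
  show ?thesis
  proof (rule complex_structureI_graph[where Q = "J_graph k"], goal_cases)
    case 1 show ?case by (rule lie_algebra_ext_euclid)
  next
    case 2 show ?case by (rule J_ext_closed)
  next
    case 3 then show ?case by (rule J_graph_iff[OF adm])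
  next
    case (4 x y x' y')
    then show ?case
      unfolding J_graph_def
      using polarized_add[of k "\<lambda>p q. Complex (rot_coord x p q) (- rot_coord y p q)"
          "\<lambda>p. Complex (tra_coord x p) (- tra_coord y p)"
          "\<lambda>p q. Complex (rot_coord x' p q) (- rot_coord y' p q)"
          "\<lambda>p. Complex (tra_coord x' p) (- tra_coord y' p)"]
      by (simp add: rot_coord_add tra_coord_add complex_add del: ext_euclid_simps)
  next
    case (5 c x y)
    then show ?case
      unfolding J_graph_def
      using polarized_scale[of k "\<lambda>p q. Complex (rot_coord x p q) (- rot_coord y p q)"
          "\<lambda>p. Complex (tra_coord x p) (- tra_coord y p)"
          "complex_of_real c"]
      by (simp add: rot_coord_smult tra_coord_smult complex_of_real_mult_Complex del: ext_euclid_simps)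
  next
    case (6 x y)
    then show ?case
      unfolding J_graph_def
      using polarized_scale[of k "\<lambda>p q. Complex (rot_coord x p q) (- rot_coord y p q)"
          "\<lambda>p. Complex (tra_coord x p) (- tra_coord y p)"
          \<i>]
      by (simp add: rot_coord_smult tra_coord_smult i_mult_Complex del: ext_euclid_simps)
  next
    case (7 x y x' y')
    let ?z = "lie_bracket ?L x x' \<oplus>\<^bsub>?L\<^esub> (-1) \<odot>\<^bsub>?L\<^esub> lie_bracket ?L y y'"
    let ?w = "lie_bracket ?L x y' \<oplus>\<^bsub>?L\<^esub> lie_bracket ?L y x'"
    let ?F = "\<lambda>x y p q. Complex (rot_coord x p q) (- rot_coord y p q)"
    let ?G = "\<lambda>x y p. Complex (tra_coord x p) (- tra_coord y p)"
    note c = 7(1-4)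
    \<comment> \<open>In coordinates, the complexified bracket is the real formula with complex entries.\<close>
    have rot: "?F ?z ?w p q = (\<Sum>r<4 * k + 3. ?F x y p r * ?F x' y' r q - ?F x' y' p r * ?F x y r q)" for p q
      by (simp add: rot_coord_add rot_coord_smult bracket_closed sm c rot_coord_bracket[OF _ _ n] complex_eq_iff
          sum_subtractf sum.distrib algebra_simps sum_negf del: ext_euclid_simps)
    have tra: "?G ?z ?w p = (\<Sum>r<4 * k + 3. ?F x y p r * ?G x' y' r - ?F x' y' p r * ?G x y r)" for p
      by (simp add: tra_coord_add tra_coord_smult bracket_closed sm c tra_coord_bracket[OF _ _ n] complex_eq_iff
          sum_subtractf sum.distrib algebra_simps sum_negf del: ext_euclid_simps)
    show ?case
      unfolding J_graph_def rot tra using 7(5,6) unfolding J_graph_def by (rule polarized_bracket)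
  qed
qed

text \<open>Both \<open>J\<close>'s have the same graph in coordinates, and the inclusion preserves coordinates.\<close>

lemma holomorphic_natural_incl:
  assumes "admissible k s n" "admissible k s' (n + 1)"
  shows "holomorphic (ext_euclid s n) (J_ext k s n) (J_ext k s' (n + 1)) (natural_incl s s' n)"
  unfolding holomorphic_def
proof
  fix x assume x: "x \<in> carrier (ext_euclid s n)"
  let ?i = "natural_incl s s' n"
  have "s \<le> 1" using assms(1) by (auto simp: admissible_def)
  then have "lie_embedding (ext_euclid s n) (ext_euclid s' (n + 1)) ?i"
    by (rule natural_incl_embedding)
  then have "?i \<in> LinearCombinations.module_hom class_ring (ext_euclid s n) (ext_euclid s' (n + 1))"
    by (auto simp: lie_embedding_def linear_map_def mod_hom_def mod_hom_axioms_def)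
  then have i: "?i y \<in> carrier (ext_euclid s' (n + 1))" if "y \<in> carrier (ext_euclid s n)" for y
    using that by (auto simp: LinearCombinations.module_hom_def simp del: ext_euclid_simps)
  have "J_graph k x (J_ext k s n x)"
    using J_graph_iff[OF assms(1) x J_ext_closed] by simp
  then have "J_graph k (?i x) (?i (J_ext k s n x))"
    unfolding J_graph_def rot_coord_natural_incl[OF x] tra_coord_natural_incl[OF x]
      rot_coord_natural_incl[OF J_ext_closed] tra_coord_natural_incl[OF J_ext_closed] .
  then show "?i (J_ext k s n x) = J_ext k s' (n + 1) (?i x)"
    using J_graph_iff[OF assms(2) i[OF x] i[OF J_ext_closed]] by simp
qed

theorem theorem3p6:
  "\<exists>(s :: nat \<Rightarrow> nat) (J :: nat \<Rightarrow> real vec \<times> real mat \<times> real vec \<Rightarrow> real vec \<times> real mat \<times> real vec).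
     (\<forall>n. s n \<in> {0, 1} \<and> complex_structure (ext_euclid (s n) n) (J n)) \<and>
     (\<forall>k. s (4 * k) = 0 \<and> s (4 * k + 1) = 1 \<and> s (4 * k + 2) = 1 \<and> s (4 * k + 3) = 0 \<and>
        holomorphic (ext_euclid 0 (4 * k)) (J (4 * k)) (J (4 * k + 1))
          (natural_incl 0 1 (4 * k)) \<and>
        holomorphic (ext_euclid 1 (4 * k + 1)) (J (4 * k + 1)) (J (4 * k + 2))
          (natural_incl 1 1 (4 * k + 1)) \<and>
        holomorphic (ext_euclid 1 (4 * k + 2)) (J (4 * k + 2)) (J (4 * k + 3))
          (natural_incl 1 0 (4 * k + 2)))"
proof -
  define s :: "nat \<Rightarrow> nat" where "s n = (if n mod 4 \<in> {1, 2} then 1 else 0)" for n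
  define J where "J n = J_ext (n div 4) (s n) n" for n
  have s: "s (4 * k) = 0" "s (4 * k + 1) = 1" "s (4 * k + 2) = 1" "s (4 * k + 3) = 0" for k
  proof -
    have "4 * k mod 4 = 0" "(4 * k + 1) mod 4 = 1" "(4 * k + 2) mod 4 = 2" "(4 * k + 3) mod 4 = 3"
      by presburger+
    then show "s (4 * k) = 0" "s (4 * k + 1) = 1" "s (4 * k + 2) = 1" "s (4 * k + 3) = 0"
      unfolding s_def by simp_all
  qed
  have J: "J (4 * k) = J_ext k 0 (4 * k)" "J (4 * k + 1) = J_ext k 1 (4 * k + 1)"
    "J (4 * k + 2) = J_ext k 1 (4 * k + 2)" "J (4 * k + 3) = J_ext k 0 (4 * k + 3)" for k
  proof -
    have "4 * k div 4 = k" "(4 * k + 1) div 4 = k" "(4 * k + 2) div 4 = k" "(4 * k + 3) div 4 = k"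
      by presburger+
    then show "J (4 * k) = J_ext k 0 (4 * k)" "J (4 * k + 1) = J_ext k 1 (4 * k + 1)"
      "J (4 * k + 2) = J_ext k 1 (4 * k + 2)" "J (4 * k + 3) = J_ext k 0 (4 * k + 3)"
      unfolding J_def s by simp_all
  qed
  have adm: "admissible (n div 4) (s n) n" for n
    unfolding admissible_def s_def by simp presburger
  have "complex_structure (ext_euclid (s n) n) (J n)" for n
    unfolding J_def by (rule complex_structure_J_ext[OF adm])
  moreover have "s n \<in> {0, 1}" for n by (simp add: s_def)
  moreover have "holomorphic (ext_euclid 0 (4 * k)) (J (4 * k)) (J (4 * k + 1)) (natural_incl 0 1 (4 * k))" for k
    unfolding J by (rule holomorphic_natural_incl) (simp_all add: admissible_def)
  moreover have "holomorphic (ext_euclid 1 (4 * k + 1)) (J (4 * k + 1)) (J (4 * k + 2)) (natural_incl 1 1 (4 * k + 1))" for k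
    unfolding J using holomorphic_natural_incl[of k 1 "4 * k + 1" 1] by (simp add: admissible_def)
  moreover have "holomorphic (ext_euclid 1 (4 * k + 2)) (J (4 * k + 2)) (J (4 * k + 3)) (natural_incl 1 0 (4 * k + 2))" for k
    unfolding J using holomorphic_natural_incl[of k 1 "4 * k + 2" 0]
    by (simp add: admissible_def numeral_3_eq_3)
  ultimately show ?thesis using s by (intro exI[of _ s] exI[of _ J]) blast
qed

end
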